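(* Let $p$ be an odd prime, $h\ge2$, $q=p^h$ and $d=q-1$. For $r\ge0$ put $D_r=d-1+r^2$ and define the unit vector $\phi_{q,r}\in\mathbb R^{\mathbb F_q^\times}$ by $$\phi_{q,r}(1)=\frac{r}{\sqrt{D_r}},\qquad \phi_{q,r}(m)=\frac1{\sqrt{D_r}}\quad(m\ne1).$$ Then for every $r\ge 0$ $$\sigma_{\min}(\mathcal M_{\phi_{q,r}})=2\sqrt q\,\frac{|r-1|}{D_r}\,\sin\!\Big(\frac{\pi}{2p}\Big).$$ Moreover, whenever $d\ge10$, $$\max_{r\ge0}\sigma_{\min}(\mathcal M_{\phi_{q,r}})=\frac{\sqrt q}{\sqrt d+1}\,\sin\!\Big(\frac{\pi}{2p}\Big),$$ and the unique maximizing parameter is $r=1+\sqrt d$. (This uniqueness is for the displayed family with distinguished coordinate $1$; choosing another distinguished coordinate in $\mathbb F_q^\times$ merely applies a multiplicative coordinate permutation, and gives a unitarily equivalent orbit measurement problem.)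
   Context: $G_q=\mathbb F_q\rtimes\mathbb F_q^\times$ is the affine group with product $(k,l)(k',l')=(k+lk',ll')$, acting on $\mathbb C^{\mathbb F_q^\times}$ by the unitary representation $(\pi_q(k,l)f)(m)=\psi(km)f(lm)$, where $\psi$ is any fixed nontrivial additive character of $\mathbb F_q$. For a vector $\phi$, $\mathcal M_\phi:\mathbb C^{\mathbb F_q^\times\times\mathbb F_q^\times}\to\mathbb C^{G_q}$ is the linear map $\mathcal M_\phi(A)(g)=\langle A\pi_q(g)\phi,\pi_q(g)\phi\rangle$. $\sigma_{\min}(\mathcal M_\phi)=\min_{A\ne0}\|\mathcal M_\phi(A)\|_{\ell^2(G_q)}/\|A\|_F$, with the Frobenius norm on matrices and counting measure on $G_q$. *)

theory Defs
  imports "HOL-Analysis.Analysis" "HOL-Algebra.Group" "HOL-Computational_Algebra.Primes"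
begin

section \<open>The multiplicative group of a field as an index type\<close>

typedef (overloaded) ('a::field) nonzero = "{x::'a. x \<noteq> 0}"
  morphisms val Nonzero
  by (rule exI[of _ 1]) simp

setup_lifting type_definition_nonzero

instantiation nonzero :: (field) comm_monoid_mult
begin
lift_definition one_nonzero :: "'a nonzero" is 1 by simp
lift_definition times_nonzero :: "'a nonzero \<Rightarrow> 'a nonzero \<Rightarrow> 'a nonzero" is "(*)" by simp
instance 
proof
  fix a b c :: "'a nonzero"
  show "a * b * c = a * (b * c)" by transfer (rule mult.assoc)
  show "a * b = b * a" by transfer (rule mult.commute)
  show "1 * a = a" by transfer (rule mult_1_left)
qed
end

lemma val_nonzero [simp]: "val m \<noteq> 0"
  using val[of m] by simp

lemma val_one [simp]: "val 1 = 1"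
  by transfer simp

lemma val_times [simp]: "val (l * m) = val l * val m"
  by transfer simp

lemma range_val: "range val = UNIV - {0 :: 'a::field}"
  unfolding type_definition.Rep_range[OF type_definition_nonzero] by blast

instance nonzero :: ("{field, finite}") finite
proof
  show "finite (UNIV :: 'a nonzero set)"
    by (rule finite_imageD[of val]) (auto simp: inj_on_def val_inject)
qed

lemma card_nonzero: "CARD('a::{field, finite} nonzero) = CARD('a) - 1"
proof -
  have "CARD('a nonzero) = card (range (val :: 'a nonzero \<Rightarrow> 'a))"
    by (rule card_image[symmetric]) (auto simp: inj_on_def val_inject)
  also have "\<dots> = CARD('a) - 1"
    unfolding range_val by (rule card_Diff_singleton) simp
  finally show ?thesis .
qed

lemma nonzero_left_inverse: "\<exists>m. m * l = (1 :: 'a::field nonzero)"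
proof (rule exI, rule val_inject[THEN iffD1])
  show "val (Nonzero (inverse (val l)) * l) = val 1"
    by (simp add: Nonzero_inverse)
qed


section \<open>The affine group and its representation\<close>

definition affine_group :: "('a::field \<times> 'a nonzero) monoid" where
  "affine_group = \<lparr>carrier = UNIV,
     monoid.mult = (\<lambda>(k, l) (k', l'). (k + val l * k', l * l')),
     one = (0, 1)\<rparr>"

definition additive_character :: "('a::field \<Rightarrow> complex) \<Rightarrow> bool" where
  "additive_character \<psi> \<longleftrightarrow>
     (\<forall>x y. \<psi> (x + y) = \<psi> x * \<psi> y) \<and> (\<forall>x. cmod (\<psi> x) = 1)"

definition affine_rep ::
  "('a::{field, finite} \<Rightarrow> complex) \<Rightarrow> 'a \<times> 'a nonzero \<Rightarrow> complex ^ 'a nonzero \<Rightarrow> complex ^ 'a nonzero"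
  where "affine_rep \<psi> g f = (\<chi> m. \<psi> (fst g * val m) * f $ (snd g * m))"

text \<open>The library's \<open>inner\<close> on \<open>complex ^ 'n\<close> is real-valued, so the Hermitian product
  is introduced separately; it is linear in its first argument.\<close>

definition cinner :: "complex ^ 'n \<Rightarrow> complex ^ 'n \<Rightarrow> complex" where
  "cinner x y = (\<Sum>i\<in>UNIV. x $ i * cnj (y $ i))"


section \<open>Orbit measurements\<close>

definition orbit_measurement ::
  "('a::{field, finite} \<Rightarrow> complex) \<Rightarrow> complex ^ 'a nonzero \<Rightarrow>
   complex ^ 'a nonzero ^ 'a nonzero \<Rightarrow> complex ^ ('a \<times> 'a nonzero)"
  where "orbit_measurement \<psi> \<phi> A =
    (\<chi> g. cinner (A *v affine_rep \<psi> g \<phi>) (affine_rep \<psi> g \<phi>))"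

text \<open>On \<open>complex ^ 'n ^ 'n\<close> the library norm is the Frobenius norm, and on \<open>complex ^ 'g\<close> it is
  the \<open>\<ell>\<^sup>2\<close> norm for counting measure. \<open>LEAST\<close> denotes a genuine minimum, which exists
  for every linear map; see \<open>sigma_min_attained\<close>.\<close>

definition sigma_min :: "(complex ^ 'n ^ 'n \<Rightarrow> complex ^ 'g) \<Rightarrow> real" where
  "sigma_min T = (LEAST s. \<exists>A. A \<noteq> 0 \<and> s = norm (T A) / norm A)"

definition unitary_matrix :: "complex ^ 'n ^ 'n \<Rightarrow> bool" where
  "unitary_matrix U \<longleftrightarrow>
     U ** (\<chi> i j. cnj (U $ j $ i)) = mat 1 \<and> (\<chi> i j. cnj (U $ j $ i)) ** U = mat 1"

text \<open>The unitary \<open>U\<close> carries the orbit of \<open>\<phi>\<close> to the orbit of \<open>\<phi>'\<close>, up to an automorphism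
  \<open>\<alpha>\<close> of the group, and intertwines the two measurement maps: the input is conjugated by \<open>U\<close>
  and the outputs are relabelled by \<open>\<alpha>\<close>, both of which preserve the norms.\<close>

definition unitarily_equivalent_orbits ::
  "('a::{field, finite} \<Rightarrow> complex) \<Rightarrow> complex ^ 'a nonzero ^ 'a nonzero \<Rightarrow>
   complex ^ 'a nonzero \<Rightarrow> complex ^ 'a nonzero \<Rightarrow> bool"
  where "unitarily_equivalent_orbits \<psi> U \<phi> \<phi>' \<longleftrightarrow>
    unitary_matrix U \<and>
    (\<exists>\<alpha> \<in> iso affine_group affine_group.
       (\<forall>g. affine_rep \<psi> (\<alpha> g) \<phi>' = U *v affine_rep \<psi> g \<phi>) \<and>
       (\<forall>A g. orbit_measurement \<psi> \<phi>' (U ** A ** (\<chi> i j. cnj (U $ j $ i))) $ \<alpha> g =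
               orbit_measurement \<psi> \<phi> A $ g))"


section \<open>The one-spike family\<close>

definition D :: "nat \<Rightarrow> real \<Rightarrow> real" where
  "D d r = real d - 1 + r\<^sup>2"

text \<open>The argument \<open>c\<close> is the distinguished coordinate.\<close>

definition spike :: "nat \<Rightarrow> 'a::{field, finite} nonzero \<Rightarrow> real \<Rightarrow> real ^ 'a nonzero" where
  "spike d c r = (\<chi> m. if m = c then r / sqrt (D d r) else 1 / sqrt (D d r))"

definition complexify :: "real ^ 'n \<Rightarrow> complex ^ 'n" where
  "complexify v = (\<chi> i. complex_of_real (v $ i))"

text \<open>Maps the basis vector at \<open>m\<close> to the one at \<open>c * m\<close>.\<close>

definition mult_perm :: "'a::{field, finite} nonzero \<Rightarrow> complex ^ 'a nonzero ^ 'a nonzero" where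
  "mult_perm c = (\<chi> i j. if i = c * j then 1 else 0)"


section \<open>Well-definedness of the notions above\<close>

lemma affine_group_group: "group (affine_group :: ('a::field \<times> 'a nonzero) monoid)"
proof (rule groupI)
  fix x :: "'a \<times> 'a nonzero"
  obtain k l where x: "x = (k, l)" by force
  obtain m where m: "m * l = 1" using nonzero_left_inverse by blast
  have "(- (val m * k), m) \<otimes>\<^bsub>affine_group\<^esub> x = \<one>\<^bsub>affine_group\<^esub>"
    by (simp add: affine_group_def x m)
  then show "\<exists>y\<in>carrier affine_group. y \<otimes>\<^bsub>affine_group\<^esub> x = \<one>\<^bsub>affine_group\<^esub>"
    by (rule bexI) (simp add: affine_group_def)
qed (simp_all add: affine_group_def split_beta distrib_left mult.assoc add.assoc)

lemma affine_rep_mult: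
  assumes "additive_character \<psi>"
  shows "affine_rep \<psi> (g \<otimes>\<^bsub>affine_group\<^esub> g') f = affine_rep \<psi> g (affine_rep \<psi> g' f)"
proof -
  obtain k l k' l' where g: "g = (k, l)" "g' = (k', l')" by force
  have "\<psi> ((k + val l * k') * val m) = \<psi> (k * val m) * \<psi> (k' * val (l * m))" for m
  proof -
    have "(k + val l * k') * val m = k * val m + k' * val (l * m)"
      by (simp add: algebra_simps)
    then show ?thesis
      using assms by (simp add: additive_character_def)
  qed
  then show ?thesis
    by (simp add: affine_group_def affine_rep_def vec_eq_iff g mult_ac)
qed

lemma affine_rep_unitary:
  assumes "additive_character \<psi>"
  shows "cinner (affine_rep \<psi> g f) (affine_rep \<psi> g f') = cinner f f'"
proof -
  obtain k l where g: "g = (k, l)" by force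
  obtain m where m: "m * l = 1" using nonzero_left_inverse by blast
  have c: "\<psi> x * cnj (\<psi> x) = 1" for x
    using assms by (simp add: additive_character_def complex_norm_square[symmetric])
  have "cinner (affine_rep \<psi> g f) (affine_rep \<psi> g f') =
      (\<Sum>i\<in>UNIV. (\<psi> (k * val i) * cnj (\<psi> (k * val i))) * (f $ (l * i) * cnj (f' $ (l * i))))"
    by (simp add: cinner_def affine_rep_def g mult_ac)
  also have "\<dots> = (\<Sum>i\<in>UNIV. f $ (l * i) * cnj (f' $ (l * i)))"
    by (simp only: c mult_1_left)
  also have "\<dots> = cinner f f'"
    unfolding cinner_def
    by (rule sum.reindex_bij_witness[of _ "(*) m" "(*) l"])
      (auto simp: mult.assoc[symmetric] m mult.commute[of l m])
  finally show ?thesis .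
qed

lemma sigma_min_attained:
  fixes T :: "complex ^ 'n ^ 'n \<Rightarrow> complex ^ 'g"
  assumes "linear T"
  shows "\<exists>A. A \<noteq> 0 \<and> sigma_min T = norm (T A) / norm A"
    and "A \<noteq> 0 \<Longrightarrow> sigma_min T \<le> norm (T A) / norm A"
proof -
  have c: "continuous_on (sphere 0 1) (\<lambda>A. norm (T A))"
    using assms by (intro continuous_on_norm linear_continuous_on) (simp add: linear_conv_bounded_linear)
  obtain A\<^sub>0 where A\<^sub>0: "norm A\<^sub>0 = 1" "\<And>A. norm A = 1 \<Longrightarrow> norm (T A\<^sub>0) \<le> norm (T A)"
    using continuous_attains_inf[OF _ _ c] by auto
  have le: "norm (T A\<^sub>0) / norm A\<^sub>0 \<le> norm (T A) / norm A" if "A \<noteq> 0" for A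
  proof -
    have "norm (T A\<^sub>0) \<le> norm (T (inverse (norm A) *\<^sub>R A))"
      using that by (intro A\<^sub>0(2)) simp
    then show ?thesis
      by (simp add: linear_scale[OF assms] A\<^sub>0(1) divide_inverse mult.commute)
  qed
  have eq: "sigma_min T = norm (T A\<^sub>0) / norm A\<^sub>0"
    unfolding sigma_min_def using A\<^sub>0(1) le
    by (intro Least_equality exI[of _ A\<^sub>0]) auto
  show "\<exists>A. A \<noteq> 0 \<and> sigma_min T = norm (T A) / norm A"
    using eq A\<^sub>0(1) by (intro exI[of _ A\<^sub>0]) auto
  show "sigma_min T \<le> norm (T A) / norm A" if "A \<noteq> 0"
    using eq le[OF that] by simp
qed

lemma linear_orbit_measurement: "linear (orbit_measurement \<psi> \<phi>)"
proof (rule linearI)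
  show "orbit_measurement \<psi> \<phi> (A + B) = orbit_measurement \<psi> \<phi> A + orbit_measurement \<psi> \<phi> B" for A B
    by (simp add: orbit_measurement_def vec_eq_iff cinner_def matrix_vector_mult_add_rdistrib
        sum.distrib distrib_right)
  show "orbit_measurement \<psi> \<phi> (r *\<^sub>R A) = r *\<^sub>R orbit_measurement \<psi> \<phi> A" for r A
  proof -
    have "(r *\<^sub>R A) *v f = r *\<^sub>R (A *v f)" for f
      by (simp add: vec_eq_iff matrix_vector_mult_def scaleR_sum_right)
    then show ?thesis
      by (simp add: orbit_measurement_def vec_eq_iff cinner_def scaleR_sum_right)
  qed
qed

lemma norm_spike:
  assumes "d = CARD('a::{field, finite}) - 1" and "d \<ge> 2"
  shows "norm (spike d (c :: 'a nonzero) r) = 1"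
proof -
  have pos: "D d r > 0"
    using assms(2) by (simp add: D_def add_pos_nonneg)
  have "(\<Sum>m\<in>UNIV. (spike d c r $ m)\<^sup>2) =
      (spike d c r $ c)\<^sup>2 + (\<Sum>m\<in>UNIV - {c}. (spike d c r $ m)\<^sup>2)"
    by (simp add: sum.remove)
  also have "\<dots> = r\<^sup>2 / D d r + (\<Sum>m\<in>UNIV - {c}. 1 / D d r)"
    using pos by (intro arg_cong2[where f = "(+)"] sum.cong) (auto simp: spike_def power_divide)
  also have "\<dots> = (r\<^sup>2 + real (d - 1)) / D d r"
    using assms by (simp add: card_nonzero add_divide_distrib)
  also have "r\<^sup>2 + real (d - 1) = D d r"
    using assms(2) by (simp add: D_def of_nat_diff)
  also have "D d r / D d r = 1"
    using pos by simp
  finally show ?thesis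
    by (simp add: norm_vec_def L2_set_def)
qed

end

theory Submission
  imports Defs "HOL-Number_Theory.Residues"
begin

text \<open>
  By Parseval in the translation variable, the squared norm of the measurement of \<open>A\<close> splits over the
  diagonals \<open>a\<^sub>s(x) = A(x, x + s)\<close>. For the one-spike vector, with \<open>S = \<Sum>\<^sub>x a\<^sub>s(x)\<close> and after substituting
  \<open>z = 1 / l\<close>, the diagonal \<open>s \<noteq> 0\<close> contributes \<open>q / D\<^sup>2\<close> times the sum over \<open>z \<noteq> 0\<close> of
  \<open>\<bar>S + (r - 1) (a\<^sub>s(z) + a\<^sub>s(z - s))\<bar>\<^sup>2\<close>. Since the terms \<open>a\<^sub>s(z) + a\<^sub>s(z - s)\<close> add up to \<open>2 S\<close>, all
  dependence on \<open>S\<close> is a nonnegative multiple of \<open>\<bar>S\<bar>\<^sup>2\<close>, and the problem reduces to the operator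
  \<open>1 +\<close> translation by \<open>s\<close>, whose orbits are \<open>p\<close>-cycles: its smallest singular value is
  \<open>min \<bar>1 + \<omega>\<bar> = 2 sin (\<pi> / 2p)\<close> over the \<open>p\<close>-th roots of unity. Equality is reached by an eigenvector
  (for which \<open>S = 0\<close>) on a coset of the prime field that avoids \<open>0\<close>, which exists because \<open>h \<ge> 2\<close>.
\<close>

section \<open>Finite Fourier analysis and cyclic shifts\<close>

text \<open>The kernel is abstract because two transforms need it: additive characters in the
  translation variable of the group, and powers of \<open>p\<close>-th roots of unity along the
  cycles of a shift.\<close>

lemma parseval:
  fixes e :: "'k \<Rightarrow> 'x \<Rightarrow> complex" and N :: real
  assumes "finite X"
    and orth: "\<And>x y. x \<in> X \<Longrightarrow> y \<in> X \<Longrightarrow>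
      (\<Sum>k\<in>K. e k x * cnj (e k y)) = (if x = y then of_real N else 0)"
  shows "(\<Sum>k\<in>K. (cmod (\<Sum>x\<in>X. e k x * f x))\<^sup>2) = N * (\<Sum>x\<in>X. (cmod (f x))\<^sup>2)"
proof -
  have "complex_of_real (\<Sum>k\<in>K. (cmod (\<Sum>x\<in>X. e k x * f x))\<^sup>2) =
      (\<Sum>k\<in>K. (\<Sum>x\<in>X. e k x * f x) * (\<Sum>y\<in>X. cnj (e k y) * cnj (f y)))"
    by (simp only: of_real_sum complex_norm_square cnj_sum complex_cnj_mult)
  also have "\<dots> = (\<Sum>k\<in>K. \<Sum>x\<in>X. \<Sum>y\<in>X. (f x * cnj (f y)) * (e k x * cnj (e k y)))"
    by (simp add: sum_product mult_ac)
  also have "\<dots> = (\<Sum>x\<in>X. \<Sum>y\<in>X. \<Sum>k\<in>K. (f x * cnj (f y)) * (e k x * cnj (e k y)))"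
    by (subst sum.swap) (intro sum.cong refl, subst sum.swap, rule refl)
  also have "\<dots> = (\<Sum>x\<in>X. \<Sum>y\<in>X. if x = y then (f x * cnj (f y)) * of_real N else 0)"
    by (intro sum.cong refl) (simp add: sum_distrib_left[symmetric] orth)
  also have "\<dots> = (\<Sum>x\<in>X. (f x * cnj (f x)) * of_real N)"
    using assms(1) by (simp add: sum.delta)
  also have "\<dots> = of_real (N * (\<Sum>x\<in>X. (cmod (f x))\<^sup>2))"
    by (simp only: of_real_sum of_real_mult complex_norm_square sum_distrib_left
        mult.commute[of _ "complex_of_real N"])
  finally show ?thesis by (simp only: of_real_eq_iff)
qed

text \<open>Expanding the squares leaves a cross term that sees \<open>b\<close> only through its
  sum. As that sum is a real multiple of \<open>S\<close>, the cross term becomes a multiple of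
  \<open>(cmod S)\<^sup>2\<close> and has no phase left.\<close>

lemma sum_norm_square_affine:
  fixes b :: "'x \<Rightarrow> complex" and \<rho> t :: real
  assumes "(\<Sum>x\<in>X. b x) = of_real t * S"
  shows "(\<Sum>x\<in>X. (cmod (S + of_real \<rho> * b x))\<^sup>2) =
    (real (card X) + 2 * \<rho> * t) * (cmod S)\<^sup>2 + \<rho>\<^sup>2 * (\<Sum>x\<in>X. (cmod (b x))\<^sup>2)"
proof -
  have "(\<Sum>x\<in>X. (cmod (S + of_real \<rho> * b x))\<^sup>2) =
      (\<Sum>x\<in>X. (cmod S)\<^sup>2 + 2 * \<rho> * Re (cnj S * b x) + \<rho>\<^sup>2 * (cmod (b x))\<^sup>2)"
    by (intro sum.cong refl) (simp only: cmod_power2, simp add: power2_eq_square algebra_simps)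
  also have "\<dots> = real (card X) * (cmod S)\<^sup>2 + 2 * \<rho> * Re (cnj S * (\<Sum>x\<in>X. b x)) +
      \<rho>\<^sup>2 * (\<Sum>x\<in>X. (cmod (b x))\<^sup>2)"
    by (simp add: sum.distrib sum_distrib_left algebra_simps)
  also have "Re (cnj S * (\<Sum>x\<in>X. b x)) = t * (cmod S)\<^sup>2"
    unfolding assms by (simp only: cmod_power2, simp add: power2_eq_square algebra_simps)
  finally show ?thesis by (simp add: algebra_simps)
qed

section \<open>Roots of unity and the modulus of \<open>1 + \<omega>\<close>\<close>

lemma sum_powers_root_of_unity:
  fixes z :: "'a::field"
  assumes "z ^ n = 1" and "z \<noteq> 1"
  shows "(\<Sum>k<n. z ^ k) = 0"
  using assms by (simp add: geometric_sum)

lemma cmod_one_plus_cis: "cmod (1 + cis t) = 2 * \<bar>cos (t / 2)\<bar>"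
proof -
  have "(cmod (1 + cis t))\<^sup>2 = 2 + 2 * cos t"
    using sin_cos_squared_add[of t]
    by (simp only: cmod_power2, simp add: power2_eq_square algebra_simps)
  also have "\<dots> = (2 * \<bar>cos (t / 2)\<bar>)\<^sup>2"
    using cos_double_cos[of "t / 2"] by (simp add: power_mult_distrib)
  finally show ?thesis
    by (rule power2_eq_imp_eq) auto
qed

lemma cmod_one_plus_root_of_unity_ge:
  assumes "odd p" and "\<omega> ^ p = 1"
  shows "2 * sin (pi / (2 * real p)) \<le> cmod (1 + \<omega>)"
proof -
  have p: "p > 0" using assms(1) by (rule odd_pos)
  then obtain k where k: "k < p" "\<omega> = cis (2 * pi * real k / real p)"
    using Complex.bij_betw_roots_unity[OF p] assms(2) by (auto simp: bij_betw_def)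
  \<comment> \<open>The half angle of the root differs from \<open>pi / 2\<close> by
    \<open>j * pi / (2 * p)\<close> in absolute value. Oddness of \<open>p\<close> forces
    \<open>j \<ge> 1\<close>, so the sine is evaluated between \<open>pi / (2 * p)\<close> and
    \<open>pi / 2\<close>, where it increases.\<close>
  define j :: int where "j = \<bar>int p - 2 * int k\<bar>"
  have "int p \<noteq> 2 * int k"
    using assms(1) by (metis even_mult_iff even_numeral even_of_nat_iff)
  then have j: "1 \<le> real_of_int j" "real_of_int j \<le> real p"
    using k(1) by (auto simp: j_def)
  have "pi * real k / real p = pi / 2 - pi * (real p - 2 * real k) / (2 * real p)"
    using p by (simp add: field_simps)
  then have "cos (pi * real k / real p) = sin (pi * (real p - 2 * real k) / (2 * real p))"
    by (simp add: sin_cos_eq[symmetric] cos_sin_eq)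
  also have "\<bar>\<dots>\<bar> = \<bar>sin (pi * real_of_int j / (2 * real p))\<bar>"
    by (auto simp: j_def abs_if algebra_simps diff_divide_distrib sin_diff)
  finally have c: "\<bar>cos (pi * real k / real p)\<bar> = \<bar>sin (pi * real_of_int j / (2 * real p))\<bar>" .
  have "pi / (2 * real p) \<le> pi * real_of_int j / (2 * real p)"
    using j p by (intro divide_right_mono) auto
  moreover have "pi * real_of_int j / (2 * real p) \<le> pi / 2"
    using j p by (simp add: field_simps)
  moreover have "- (pi / 2) \<le> pi / (2 * real p)" 
    by (rule order_trans[of _ 0]) auto
  ultimately have "sin (pi / (2 * real p)) \<le> sin (pi * real_of_int j / (2 * real p))"
    by (intro sin_monotone_2pi_le) auto
  then show ?thesis
    using c by (simp add: k(2) cmod_one_plus_cis mult.assoc)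
qed

lemma sum_shift_cyclic:
  fixes f :: "nat \<Rightarrow> 'a::ab_group_add"
  assumes "f p = f 0"
  shows "(\<Sum>j<p. f (Suc j)) = (\<Sum>j<p. f j)"
  using sum.lessThan_Suc_shift[of f p] assms by simp

text \<open>Discrete Fourier transform along the orbits of \<open>T\<close> diagonalises \<open>a \<mapsto> a + a \<circ> T\<close>,
  with eigenvalues \<open>1 + \<omega>\<close> for \<open>p\<close>-th roots of unity \<open>\<omega>\<close>.\<close>

lemma sum_cmod_add_shift_ge:
  fixes a :: "'b::finite \<Rightarrow> complex" and T :: "'b \<Rightarrow> 'b"
  assumes "odd p" and T: "\<And>x. (T ^^ p) x = x"
  shows "(2 * sin (pi / (2 * real p)))\<^sup>2 * (\<Sum>x\<in>UNIV. (cmod (a x))\<^sup>2) \<le>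
    (\<Sum>x\<in>UNIV. (cmod (a x + a (T x)))\<^sup>2)"
proof -
  have p: "p > 0" using assms(1) by (rule odd_pos)
  define \<omega> where "\<omega> = (\<lambda>k. cis (2 * pi * real k / real p))"
  have \<omega>p: "\<omega> k ^ p = 1" for k
  proof -
    have "real p * (2 * pi * real k / real p) = 2 * pi * real k" using p by simp
    then show ?thesis
      unfolding \<omega>_def Complex.DeMoivre by (metis cis_multiple_2pi Ints_of_nat)
  qed
  \<comment> \<open>The Fourier matrix is symmetric; exchanging index and exponent turns the
    orthogonality sum over \<open>k\<close> into a geometric sum.\<close>
  have \<omega>swap: "\<omega> k ^ j = \<omega> j ^ k" for j k
    unfolding \<omega>_def Complex.DeMoivre by (rule arg_cong[where f = cis]) simp
  have n1: "cmod (\<omega> k) = 1" for k by (simp add: \<omega>_def)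
  have inj: "inj_on \<omega> {..<p}"
    using Complex.bij_betw_roots_unity[OF p] by (simp add: bij_betw_def \<omega>_def)
  have orth: "(\<Sum>k<p. \<omega> k ^ i * cnj (\<omega> k ^ j)) = (if i = j then of_real (real p) else 0)"
    if "i \<in> {..<p}" "j \<in> {..<p}" for i j
  proof -
    have cc: "\<omega> j * cnj (\<omega> j) = 1" for j
      using n1[of j] by (simp add: complex_norm_square[symmetric])
    have "(\<omega> i * cnj (\<omega> j)) ^ p = 1"
      using \<omega>p by (simp add: power_mult_distrib flip: complex_cnj_power)
    moreover have "\<omega> i * cnj (\<omega> j) \<noteq> 1" if "i \<noteq> j"
    proof
      assume "\<omega> i * cnj (\<omega> j) = 1"
      then have "\<omega> i * (\<omega> j * cnj (\<omega> j)) = \<omega> j" by (simp add: mult_ac)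
      then show False
        using inj \<open>i \<noteq> j\<close> \<open>i \<in> _\<close> \<open>j \<in> _\<close> by (auto simp: cc inj_on_def)
    qed
    ultimately have "(\<Sum>k<p. (\<omega> i * cnj (\<omega> j)) ^ k) = (if i = j then of_real (real p) else 0)"
      using sum_powers_root_of_unity cc by auto
    then show ?thesis
      by (simp add: \<omega>swap[of _ i] \<omega>swap[of _ j] power_mult_distrib)
  qed
  \<comment> \<open>The transform always takes \<open>p\<close> steps from \<open>x\<close>, even if
    the orbit of \<open>x\<close> is shorter, so fixed points of \<open>T\<close> need no separate
    treatment.\<close>
  define F where "F = (\<lambda>a k x. \<Sum>j<p. \<omega> k ^ j * a ((T ^^ j) x) :: complex)"
  \<comment> \<open>One factor \<open>p\<close> comes from Parseval in \<open>j\<close>; the other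
    counts the \<open>p\<close> iterates \<open>T ^^ j\<close>, each of which permutes the
    points.\<close>
  have parseval_F: "(\<Sum>x\<in>UNIV. \<Sum>k<p. (cmod (F c k x))\<^sup>2) = real p * real p * (\<Sum>x\<in>UNIV. (cmod (c x))\<^sup>2)"
    for c :: "'b \<Rightarrow> complex"
  proof -
    have "bij T"
    proof (rule bij_betw_byWitness[where f' = "T ^^ (p - 1)"])
      have "(T ^^ (p - 1)) (T x) = (T ^^ p) x" "T ((T ^^ (p - 1)) x) = (T ^^ p) x" for x
        using p by (cases p; simp add: funpow_swap1)+
      then show "\<forall>x\<in>UNIV. (T ^^ (p - 1)) (T x) = x" "\<forall>x\<in>UNIV. T ((T ^^ (p - 1)) x) = x"
        by (simp_all add: T)
    qed auto
    then have "bij (T ^^ j)" for j by (rule bij_betw_funpow)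
    then have *: "(\<Sum>x\<in>UNIV. (cmod (c ((T ^^ j) x)))\<^sup>2) = (\<Sum>x\<in>UNIV. (cmod (c x))\<^sup>2)" for j
      by (rule sum.reindex_bij_betw[of "T ^^ j" UNIV UNIV])
    have "(\<Sum>x\<in>UNIV. \<Sum>k<p. (cmod (F c k x))\<^sup>2) =
        (\<Sum>x\<in>UNIV. real p * (\<Sum>j<p. (cmod (c ((T ^^ j) x)))\<^sup>2))"
      unfolding F_def using orth by (intro sum.cong refl parseval) auto
    also have "\<dots> = real p * (\<Sum>j<p. \<Sum>x\<in>UNIV. (cmod (c ((T ^^ j) x)))\<^sup>2)"
      by (simp add: sum_distrib_left[symmetric] sum.swap[of _ _ UNIV])
    finally show ?thesis by (simp add: *)
  qed
  \<comment> \<open>Moving the starting point along \<open>T\<close> only changes the phase of a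
    coefficient, since \<open>T ^^ p\<close> and \<open>\<omega> k ^ p\<close> are both trivial and
    close the cycle.\<close>
  have shift: "\<omega> k * F a k (T x) = F a k x" for k x
  proof -
    have "\<omega> k * F a k (T x) = (\<Sum>j<p. \<omega> k ^ Suc j * a ((T ^^ Suc j) x))"
      unfolding F_def by (simp add: sum_distrib_left mult.assoc funpow_swap1)
    also have "\<dots> = F a k x"
      unfolding F_def by (rule sum_shift_cyclic) (simp add: T \<omega>p)
    finally show ?thesis .
  qed
  have le: "(2 * sin (pi / (2 * real p)))\<^sup>2 * (cmod (F a k x))\<^sup>2 \<le>
      (cmod (F (\<lambda>x. a x + a (T x)) k x))\<^sup>2" for k x
  proof -
    have "F (\<lambda>x. a x + a (T x)) k x = F a k x + F a k (T x)"
      unfolding F_def by (simp add: distrib_left sum.distrib funpow_swap1)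
    also have "\<dots> = (1 + \<omega> k) * F a k (T x)"
      using shift[of k x] by (simp add: distrib_right)
    finally have "cmod (F (\<lambda>x. a x + a (T x)) k x) = cmod (1 + \<omega> k) * cmod (F a k x)"
      using shift[of k x] n1[of k] by (metis mult_1 norm_mult)
    moreover have "2 * sin (pi / (2 * real p)) \<le> cmod (1 + \<omega> k)"
      by (rule cmod_one_plus_root_of_unity_ge) (use assms \<omega>p in auto)
    moreover have "0 \<le> sin (pi / (2 * real p))"
      using p by (intro sin_ge_zero) (auto simp: field_simps)
    ultimately show ?thesis
      by (simp only: power_mult_distrib[symmetric]) (intro power_mono mult_right_mono, auto)
  qed
  have "real p * real p * ((2 * sin (pi / (2 * real p)))\<^sup>2 * (\<Sum>x\<in>UNIV. (cmod (a x))\<^sup>2)) =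
      (\<Sum>x\<in>UNIV. \<Sum>k<p. (2 * sin (pi / (2 * real p)))\<^sup>2 * (cmod (F a k x))\<^sup>2)"
    by (simp only: sum_distrib_left[symmetric] parseval_F) (simp add: mult_ac)
  also have "\<dots> \<le> (\<Sum>x\<in>UNIV. \<Sum>k<p. (cmod (F (\<lambda>x. a x + a (T x)) k x))\<^sup>2)"
    by (intro sum_mono le)
  also have "\<dots> = real p * real p * (\<Sum>x\<in>UNIV. (cmod (a x + a (T x)))\<^sup>2)"
    by (rule parseval_F)
  finally show ?thesis
    using p by (subst (asm) mult_le_cancel_left_pos) auto
qed

section \<open>Decomposition of the measurement along diagonals\<close>

lemma additive_character_orthogonality:
  fixes \<psi> :: "'a::{field, finite} \<Rightarrow> complex"
  assumes \<psi>: "additive_character \<psi>" and nontrivial: "\<exists>x. \<psi> x \<noteq> 1"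
  shows "(\<Sum>k\<in>UNIV. \<psi> (k * x) * cnj (\<psi> (k * y))) = (if x = y then of_real (real CARD('a)) else 0)"
proof -
  have add: "\<psi> (u + v) = \<psi> u * \<psi> v" for u v
    using \<psi> by (simp add: additive_character_def)
  have unit: "\<psi> u * cnj (\<psi> u) = 1" for u
    using \<psi> by (simp add: additive_character_def complex_norm_square[symmetric])
  show ?thesis
  proof (cases "x = y")
    case True
    then show ?thesis by (simp add: unit)
  next
    case False
    obtain u where u: "\<psi> u \<noteq> 1" using nontrivial by blast
    have "\<psi> (k * x) * cnj (\<psi> (k * y)) = \<psi> (k * (x - y))" for k
      using add[of "k * (x - y)" "k * y"] unit[of "k * y"] by (simp add: algebra_simps)
    then have "(\<Sum>k\<in>UNIV. \<psi> (k * x) * cnj (\<psi> (k * y))) = (\<Sum>k\<in>UNIV. \<psi> (k * (x - y)))"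
      by simp
    also have "\<dots> = (\<Sum>k\<in>UNIV. \<psi> k)"
      by (rule sum.reindex_bij_witness[of _ "\<lambda>k. k / (x - y)" "\<lambda>k. k * (x - y)"]) (use False in auto)
    also have "\<dots> = 0"
    proof -
      have "\<psi> u * (\<Sum>k\<in>UNIV. \<psi> k) = (\<Sum>k\<in>UNIV. \<psi> (u + k))"
        by (simp add: sum_distrib_left add)
      also have "\<dots> = (\<Sum>k\<in>UNIV. \<psi> k)"
        by (rule sum.reindex_bij_witness[of _ "\<lambda>k. k - u" "\<lambda>k. u + k"]) auto
      finally show ?thesis using u by simp
    qed
    finally show ?thesis using False by simp
  qed
qed

section \<open>Matrix entries indexed by diagonals\<close>

lemma sum_nonzero:
  fixes g :: "'a::{field, finite} nonzero \<Rightarrow> 'b::comm_monoid_add"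
  shows "(\<Sum>m\<in>UNIV. g m) = (\<Sum>x\<in>UNIV. if x = 0 then 0 else g (Nonzero x))"
proof -
  have "(\<Sum>m\<in>UNIV. g m) = (\<Sum>x\<in>UNIV - {0}. g (Nonzero x))"
    by (rule sum.reindex_bij_witness[of _ Nonzero val]) (auto simp: Nonzero_inverse val_inverse)
  also have "\<dots> = (\<Sum>x\<in>UNIV. if x = 0 then 0 else g (Nonzero x))"
    by (rule sum.mono_neutral_cong_left) auto
  finally show ?thesis .
qed

text \<open>The substitution \<open>y = x + s\<close> makes the difference of the two indices the
  outer variable. The guard is needed because \<open>Nonzero 0\<close> is unspecified.\<close>

lemma sum_nonzero_pairs:
  fixes g :: "'a::{field, finite} nonzero \<Rightarrow> 'a nonzero \<Rightarrow> 'b::comm_monoid_add"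
  shows "(\<Sum>m\<in>UNIV. \<Sum>n\<in>UNIV. g m n) =
    (\<Sum>s\<in>UNIV. \<Sum>x\<in>UNIV. if x = 0 \<or> x + s = 0 then 0 else g (Nonzero x) (Nonzero (x + s)))"
proof -
  have "(\<Sum>m\<in>UNIV. \<Sum>n\<in>UNIV. g m n) =
      (\<Sum>x\<in>UNIV. \<Sum>y\<in>UNIV. if x = 0 \<or> y = 0 then 0 else g (Nonzero x) (Nonzero y))"
    by (subst sum_nonzero, subst sum_nonzero) (auto intro!: sum.cong)
  also have "\<dots> = (\<Sum>x\<in>UNIV. \<Sum>s\<in>UNIV. if x = 0 \<or> x + s = 0 then 0 else g (Nonzero x) (Nonzero (x + s)))"
  proof (rule sum.cong[OF refl])
    fix x
    show "(\<Sum>y\<in>UNIV. if x = 0 \<or> y = 0 then 0 else g (Nonzero x) (Nonzero y)) =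
        (\<Sum>s\<in>UNIV. if x = 0 \<or> x + s = 0 then 0 else g (Nonzero x) (Nonzero (x + s)))"
      by (rule sum.reindex_bij_witness[of _ "\<lambda>s. x + s" "\<lambda>y. y - x"]) auto
  qed
  also have "\<dots> = (\<Sum>s\<in>UNIV. \<Sum>x\<in>UNIV. if x = 0 \<or> x + s = 0 then 0 else g (Nonzero x) (Nonzero (x + s)))"
    by (rule sum.swap)
  finally show ?thesis .
qed

text \<open>Extension by zero makes each diagonal a function on the whole additive group, on which
  translation by \<open>s\<close> acts cyclically.\<close>

definition diagonal ::
  "complex ^ 'a::{field, finite} nonzero ^ 'a nonzero \<Rightarrow> 'a \<Rightarrow> 'a \<Rightarrow> complex" where
  "diagonal A s x = (if x = 0 \<or> x + s = 0 then 0 else A $ Nonzero x $ Nonzero (x + s))"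

lemma diagonal_eq_0 [simp]: "diagonal A s 0 = 0" "diagonal A s (- s) = 0"
  by (simp_all add: diagonal_def)

lemma norm_matrix_power2:
  fixes A :: "complex ^ 'a::{field, finite} nonzero ^ 'a nonzero"
  shows "(norm A)\<^sup>2 = (\<Sum>s\<in>UNIV. \<Sum>x\<in>UNIV. (cmod (diagonal A s x))\<^sup>2)"
proof -
  have "(norm A)\<^sup>2 = (\<Sum>m\<in>UNIV. \<Sum>n\<in>UNIV. (cmod (A $ m $ n))\<^sup>2)"
    by (simp add: norm_vec_def L2_set_def sum_nonneg)
  also have "\<dots> = (\<Sum>s\<in>UNIV. \<Sum>x\<in>UNIV. (cmod (diagonal A s x))\<^sup>2)"
    unfolding sum_nonzero_pairs by (intro sum.cong refl) (simp add: diagonal_def)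
  finally show ?thesis .
qed

text \<open>These are the Fourier coefficients of the measurement in the translation variable
  \<open>k\<close>, for fixed \<open>l\<close>. Terms containing the unspecified
  \<open>Nonzero 0\<close> vanish because \<open>diagonal\<close> is zero there.\<close>

definition correlation ::
  "real ^ 'a::{field, finite} nonzero \<Rightarrow> complex ^ 'a nonzero ^ 'a nonzero \<Rightarrow> 'a nonzero \<Rightarrow> 'a \<Rightarrow> complex"
  where "correlation v A l s = (\<Sum>x\<in>UNIV. diagonal A s x *
    of_real (v $ (l * Nonzero x) * v $ (l * Nonzero (x + s))))"

text \<open>The two phases at indices \<open>x\<close> and \<open>x + s\<close> combine to
  \<open>\<psi> (k * s)\<close>, which depends on the diagonal only.\<close>

lemma orbit_measurement_eq:
  assumes \<psi>: "additive_character \<psi>"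
  shows "orbit_measurement \<psi> (complexify v) A $ (k, l) = (\<Sum>s\<in>UNIV. \<psi> (k * s) * correlation v A l s)"
proof -
  have add: "\<psi> (u + v) = \<psi> u * \<psi> v" for u v
    using \<psi> by (simp add: additive_character_def)
  have unit: "\<psi> u * cnj (\<psi> u) = 1" for u
    using \<psi> by (simp add: additive_character_def complex_norm_square[symmetric])
  have "orbit_measurement \<psi> (complexify v) A $ (k, l) =
      (\<Sum>m\<in>UNIV. \<Sum>n\<in>UNIV. (\<psi> (k * val n) * cnj (\<psi> (k * val m))) *
        (A $ m $ n * of_real (v $ (l * m) * v $ (l * n))))"
    by (simp add: orbit_measurement_def cinner_def affine_rep_def complexify_def
        matrix_vector_mult_def sum_distrib_left sum_distrib_right mult_ac)
  also have "\<dots> = (\<Sum>s\<in>UNIV. \<psi> (k * s) * correlation v A l s)"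
    unfolding sum_nonzero_pairs correlation_def sum_distrib_left
  proof (intro sum.cong refl)
    fix s x
    have "\<psi> (k * (x + s)) * cnj (\<psi> (k * x)) = \<psi> (k * s)"
      using unit[of "k * x"] by (simp add: distrib_left add mult_ac)
    then show "(if x = 0 \<or> x + s = 0 then 0 else
        \<psi> (k * val (Nonzero (x + s))) * cnj (\<psi> (k * val (Nonzero x))) *
        (A $ Nonzero x $ Nonzero (x + s) *
         complex_of_real (v $ (l * Nonzero x) * v $ (l * Nonzero (x + s))))) =
      \<psi> (k * s) * (diagonal A s x *
         complex_of_real (v $ (l * Nonzero x) * v $ (l * Nonzero (x + s))))"
      by (simp add: diagonal_def Nonzero_inverse)
  qed
  finally show ?thesis .
qed

lemma norm_orbit_measurement_power2:
  fixes \<psi> :: "'a::{field, finite} \<Rightarrow> complex"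
  assumes "additive_character \<psi>" and "\<exists>x. \<psi> x \<noteq> 1"
  shows "(norm (orbit_measurement \<psi> (complexify v) A))\<^sup>2 =
    real CARD('a) * (\<Sum>s\<in>UNIV. \<Sum>l\<in>UNIV. (cmod (correlation v A l s))\<^sup>2)"
proof -
  have "(norm (orbit_measurement \<psi> (complexify v) A))\<^sup>2 =
      (\<Sum>g\<in>UNIV \<times> UNIV. (cmod (orbit_measurement \<psi> (complexify v) A $ g))\<^sup>2)"
    by (simp add: norm_vec_def L2_set_def sum_nonneg)
  also have "\<dots> = (\<Sum>l\<in>UNIV. \<Sum>k\<in>UNIV. (cmod (\<Sum>s\<in>UNIV. \<psi> (k * s) * correlation v A l s))\<^sup>2)"
    by (simp add: sum.cartesian_product' orbit_measurement_eq[OF assms(1)] del: UNIV_Times_UNIV)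
      (rule sum.swap)
  also have "\<dots> = (\<Sum>l\<in>UNIV. real CARD('a) * (\<Sum>s\<in>UNIV. (cmod (correlation v A l s))\<^sup>2))"
    using additive_character_orthogonality[OF assms] by (intro sum.cong refl parseval) auto
  finally show ?thesis
    by (subst sum.swap) (simp add: sum_distrib_left)
qed

section \<open>The one-spike vector\<close>

lemma D_pos: "d \<ge> 2 \<Longrightarrow> D d r > 0"
  by (simp add: D_def add_pos_nonneg)

text \<open>Up to the factor \<open>1 / D d r\<close> every weight is 1, except where one of the two
  indices meets the spike, that is at \<open>x = z l\<close> or \<open>x = z l - s\<close>. For
  \<open>s = 0\<close> these positions coincide and the weight is \<open>r\<^sup>2\<close>;
  otherwise they are distinct and each has weight \<open>r\<close>. The corrections are the excesses
  over 1.\<close>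

lemma correlation_spike:
  fixes A :: "complex ^ 'a::{field, finite} nonzero ^ 'a nonzero"
  assumes "d \<ge> 2"
  defines "z \<equiv> \<lambda>l. inverse (val l)"
  shows "of_real (D d r) * correlation (spike d 1 r) A l s =
    (\<Sum>x\<in>UNIV. diagonal A s x) +
    (if s = 0 then of_real (r\<^sup>2 - 1) * diagonal A s (z l)
     else of_real (r - 1) * (diagonal A s (z l) + diagonal A s (z l - s)))"
proof -
  have D: "D d r > 0" using assms(1) by (rule D_pos)
  have eq1: "l * Nonzero x = 1 \<longleftrightarrow> x = z l" if "x \<noteq> 0" for x
  proof -
    have "l * Nonzero x = 1 \<longleftrightarrow> val l * x = 1"
      using that by (simp add: val_inject[symmetric] Nonzero_inverse)
    then show ?thesis by (auto simp: z_def field_simps)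
  qed
  have "of_real (D d r) * correlation (spike d 1 r) A l s =
    (\<Sum>x\<in>UNIV. diagonal A s x +
      (if s = 0 then of_real (r\<^sup>2 - 1) * (if x = z l then diagonal A s x else 0)
       else of_real (r - 1) * ((if x = z l then diagonal A s x else 0) +
         (if x = z l - s then diagonal A s x else 0))))"
    unfolding correlation_def sum_distrib_left
  proof (intro sum.cong refl)
    fix x
    show "of_real (D d r) * (diagonal A s x *
        of_real (spike d 1 r $ (l * Nonzero x) * spike d 1 r $ (l * Nonzero (x + s)))) =
      diagonal A s x +
      (if s = 0 then of_real (r\<^sup>2 - 1) * (if x = z l then diagonal A s x else 0)
       else of_real (r - 1) * ((if x = z l then diagonal A s x else 0) +
         (if x = z l - s then diagonal A s x else 0)))"
    \<comment> \<open>Where \<open>x\<close> or \<open>x + s\<close> is zero both sides vanish with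
      the diagonal entry; elsewhere \<open>eq1\<close> applies to both indices.\<close>
    proof (cases "x = 0 \<or> x + s = 0")
      case True
      then have "diagonal A s x = 0" by (simp add: diagonal_def)
      then show ?thesis by (simp only: if_cancel mult_zero_left mult_zero_right add_0_left)
    next
      case False
      define a P Q where "a = diagonal A s x" and "P \<longleftrightarrow> x = z l" and "Q \<longleftrightarrow> x = z l - s"
      have PQ: "if s = 0 then P = Q else \<not> (P \<and> Q)"
        by (auto simp: P_def Q_def)
      have "x + s = z l \<longleftrightarrow> Q"
        by (simp add: Q_def eq_diff_eq)
      then have w: "D d r * (spike d 1 r $ (l * Nonzero x) * spike d 1 r $ (l * Nonzero (x + s))) =
          (if P then r else 1) * (if Q then r else 1)"
        using D False by (simp add: spike_def eq1 P_def)
      have "of_real (D d r) * (a * of_real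
          (spike d 1 r $ (l * Nonzero x) * spike d 1 r $ (l * Nonzero (x + s)))) =
        a * of_real ((if P then r else 1) * (if Q then r else 1))"
        unfolding w[symmetric] by (simp only: of_real_mult mult_ac)
      also have "\<dots> = a + (if s = 0 then of_real (r\<^sup>2 - 1) * (if P then a else 0)
          else of_real (r - 1) * ((if P then a else 0) + (if Q then a else 0)))"
        using PQ by (cases P; cases Q; cases "s = 0") (simp_all add: algebra_simps power2_eq_square)
      finally show ?thesis
        unfolding a_def P_def Q_def .
    qed
  qed
  also have "\<dots> = (\<Sum>x\<in>UNIV. diagonal A s x) +
    (if s = 0 then of_real (r\<^sup>2 - 1) * diagonal A s (z l)
     else of_real (r - 1) * (diagonal A s (z l) + diagonal A s (z l - s)))"
    by (simp add: sum.distrib sum_distrib_left[symmetric])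
  finally show ?thesis .
qed

lemma sum_correlation_spike_power2:
  fixes A :: "complex ^ 'a::{field, finite} nonzero ^ 'a nonzero"
  assumes d: "d = CARD('a) - 1" "d \<ge> 2"
  shows "(D d r)\<^sup>2 * (\<Sum>l\<in>UNIV. (cmod (correlation (spike d 1 r) A l s))\<^sup>2) =
    (if s = 0
     then (real d + 2 * (r\<^sup>2 - 1)) * (cmod (\<Sum>x\<in>UNIV. diagonal A s x))\<^sup>2 +
       (r\<^sup>2 - 1)\<^sup>2 * (\<Sum>x\<in>UNIV. (cmod (diagonal A s x))\<^sup>2)
     else (real d + 4 * (r - 1)) * (cmod (\<Sum>x\<in>UNIV. diagonal A s x))\<^sup>2 +
       (r - 1)\<^sup>2 * (\<Sum>x\<in>UNIV. (cmod (diagonal A s x + diagonal A s (x - s)))\<^sup>2))"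
proof -
  define \<rho> where "\<rho> = (if s = 0 then r\<^sup>2 - 1 else r - 1)"
  \<comment> \<open>Off the main diagonal each entry occurs in \<open>b\<close> at two positions,
    hence the factor 2.\<close>
  define t where "t = (if s = 0 then 1 else 2 :: real)"
  define b where "b = (\<lambda>x. if s = 0 then diagonal A s x else diagonal A s x + diagonal A s (x - s))"
  define S where "S = (\<Sum>x\<in>UNIV. diagonal A s x)"
  \<comment> \<open>Both \<open>diagonal A s 0\<close> and \<open>diagonal A s (- s)\<close> are
    zero. Hence sums of \<open>b\<close> over the nonzero elements, which the substitution
    \<open>1 / l\<close> produces, agree with sums over the whole field, where translation
    acts.\<close>
  have b0: "b 0 = 0" by (simp add: b_def)
  have "(\<Sum>x\<in>UNIV. diagonal A s (x - s)) = S"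
    unfolding S_def by (rule sum.reindex_bij_witness[of _ "\<lambda>x. x + s" "\<lambda>x. x - s"]) auto
  then have "(\<Sum>x\<in>UNIV. b x) = of_real t * S"
    by (simp add: b_def t_def S_def sum.distrib)
  then have sum_b: "(\<Sum>x\<in>UNIV - {0}. b x) = of_real t * S"
    by (simp add: sum_diff1 b0)
  have "(D d r)\<^sup>2 * (\<Sum>l\<in>UNIV. (cmod (correlation (spike d 1 r) A l s))\<^sup>2) =
      (\<Sum>l\<in>UNIV. (cmod (of_real (D d r) * correlation (spike d 1 r) A l s))\<^sup>2)"
    by (simp add: norm_mult power_mult_distrib sum_distrib_left)
  also have "\<dots> = (\<Sum>l::'a nonzero\<in>UNIV. (cmod (S + of_real \<rho> * b (inverse (val l))))\<^sup>2)"
    unfolding correlation_spike[OF d(2)] by (auto simp: S_def \<rho>_def b_def intro!: sum.cong)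
  also have "\<dots> = (\<Sum>x\<in>UNIV - {0}. (cmod (S + of_real \<rho> * b x))\<^sup>2)"
    by (rule sum.reindex_bij_witness[of _ "\<lambda>x. Nonzero (inverse x)" "\<lambda>l. inverse (val l)"])
      (auto simp: Nonzero_inverse val_inverse)
  also have "\<dots> = (real (card (UNIV - {0 :: 'a})) + 2 * \<rho> * t) * (cmod S)\<^sup>2 +
      \<rho>\<^sup>2 * (\<Sum>x\<in>UNIV - {0}. (cmod (b x))\<^sup>2)"
    by (rule sum_norm_square_affine[OF sum_b])
  also have "(\<Sum>x\<in>UNIV - {0}. (cmod (b x))\<^sup>2) = (\<Sum>x\<in>UNIV. (cmod (b x))\<^sup>2)"
    by (simp add: sum_diff1 b0)
  also have "card (UNIV - {0 :: 'a}) = d"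
    by (simp add: d(1) card_Diff_singleton)
  finally show ?thesis
    by (simp add: \<rho>_def t_def b_def S_def)
qed

section \<open>The smallest singular value\<close>

lemma CHAR_eq_of_CARD_prime_power:
  assumes "prime p" and "CARD('a::{field, finite}) = p ^ h"
  shows "CHAR('a) = p"
proof -
  have dvd: "CHAR('a) dvd p ^ h"
    using CHAR_dvd_CARD[where 'a = 'a] assms(2) by simp
  moreover have "p ^ h > 0" using assms(1) by (simp add: prime_gt_0_nat)
  ultimately have "CHAR('a) > 0" by (auto intro: Nat.gr0I)
  then have "prime CHAR('a)" by (rule prime_CHAR_semidom)
  then show ?thesis
    using dvd assms(1) by (metis prime_dvd_power primes_dvd_imp_eq)
qed

text \<open>The upper bound is \<open>sin (pi / 6) = 1 / 2\<close> at \<open>p = 3\<close>; it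
  ensures that the main diagonal does not lower the minimum.\<close>

lemma sin_pi_half_bounds:
  assumes "p \<ge> 3"
  shows "0 < sin (pi / (2 * real p))" and "2 * sin (pi / (2 * real p)) \<le> 1"
proof -
  show "0 < sin (pi / (2 * real p))"
    using assms by (intro sin_gt_zero) (auto simp: field_simps)
  have "sin (pi / (2 * real p)) \<le> sin (pi / 6)"
  proof (rule sin_monotone_2pi_le)
    show "- (pi / 2) \<le> pi / (2 * real p)"
      by (rule order_trans[of _ 0]) auto
    show "pi / (2 * real p) \<le> pi / 6"
      using assms by (intro divide_left_mono) auto
  qed auto
  then show "2 * sin (pi / (2 * real p)) \<le> 1"
    by (simp add: sin_30)
qed

lemma norm_orbit_measurement_spike_power2:
  fixes \<psi> :: "'a::{field, finite} \<Rightarrow> complex"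
  assumes "additive_character \<psi>" and "\<exists>x. \<psi> x \<noteq> 1" and d: "d = CARD('a) - 1" "d \<ge> 2"
  shows "(D d r)\<^sup>2 * (norm (orbit_measurement \<psi> (complexify (spike d 1 r)) A))\<^sup>2 =
    real CARD('a) * (\<Sum>s\<in>UNIV.
      (if s = 0
       then (real d + 2 * (r\<^sup>2 - 1)) * (cmod (\<Sum>x\<in>UNIV. diagonal A s x))\<^sup>2 +
         (r\<^sup>2 - 1)\<^sup>2 * (\<Sum>x\<in>UNIV. (cmod (diagonal A s x))\<^sup>2)
       else (real d + 4 * (r - 1)) * (cmod (\<Sum>x\<in>UNIV. diagonal A s x))\<^sup>2 +
         (r - 1)\<^sup>2 * (\<Sum>x\<in>UNIV. (cmod (diagonal A s x + diagonal A s (x - s)))\<^sup>2)))"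
  unfolding norm_orbit_measurement_power2[OF assms(1,2)] sum_correlation_spike_power2[OF d, symmetric]
  by (simp add: sum_distrib_left mult_ac)

text \<open>The rank-one contributions of the diagonal sums are nonnegative, so they can be dropped;
  on the main diagonal the factor \<open>r + 1 \<ge> 1 \<ge> 2 sin (\<pi> / 2p)\<close> gives at least the same bound.\<close>

lemma norm_orbit_measurement_spike_ge:
  fixes \<psi> :: "'a::{field, finite} \<Rightarrow> complex"
  assumes \<psi>: "additive_character \<psi>" "\<exists>x. \<psi> x \<noteq> 1"
    and p: "prime p" "odd p" "CARD('a) = p ^ h"
    and d: "d = CARD('a) - 1" "d \<ge> 4" and r: "r \<ge> 0"
  shows "2 * sqrt (real CARD('a)) * (\<bar>r - 1\<bar> / D d r) * sin (pi / (2 * real p)) * norm A \<le>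
    norm (orbit_measurement \<psi> (complexify (spike d 1 r)) A)"
proof -
  have "p \<noteq> 2" using p(2) by auto
  then have "p \<ge> 3" using prime_ge_2_nat[OF p(1)] by linarith
  note c = sin_pi_half_bounds[OF this]
  define c where "c = 2 * sin (pi / (2 * real p))"
  have c01: "0 \<le> c" "c \<le> 1" using c by (simp_all add: c_def)
  have D: "D d r > 0" using d(2) by (intro D_pos) simp
  have char: "of_nat p = (0 :: 'a)"
    using CHAR_eq_of_CARD_prime_power[OF p(1,3)] by (metis of_nat_CHAR)
  \<comment> \<open>Characteristic \<open>p\<close> makes the \<open>p\<close>-th iterate of
    translation by \<open>- s\<close> the identity, as the cyclic estimate requires.\<close>
  have cyc: "c\<^sup>2 * (\<Sum>x\<in>UNIV. (cmod (a x))\<^sup>2) \<le> (\<Sum>x\<in>UNIV. (cmod (a x + a (x - s)))\<^sup>2)"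
    for a :: "'a \<Rightarrow> complex" and s
  proof -
    have "((\<lambda>x. x - s) ^^ j) x = x - of_nat j * s" for j x
      by (induction j) (simp_all add: algebra_simps)
    then show ?thesis
      unfolding c_def using p(2) char by (intro sum_cmod_add_shift_ge) simp_all
  qed
  have "(r - 1)\<^sup>2 * c\<^sup>2 * (norm A)\<^sup>2 = (\<Sum>s\<in>UNIV. (r - 1)\<^sup>2 * (c\<^sup>2 * (\<Sum>x\<in>UNIV. (cmod (diagonal A s x))\<^sup>2)))"
    by (simp add: norm_matrix_power2 sum_distrib_left mult.assoc)
  also have "\<dots> \<le> (\<Sum>s\<in>UNIV.
      (if s = 0
       then (real d + 2 * (r\<^sup>2 - 1)) * (cmod (\<Sum>x\<in>UNIV. diagonal A s x))\<^sup>2 +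
         (r\<^sup>2 - 1)\<^sup>2 * (\<Sum>x\<in>UNIV. (cmod (diagonal A s x))\<^sup>2)
       else (real d + 4 * (r - 1)) * (cmod (\<Sum>x\<in>UNIV. diagonal A s x))\<^sup>2 +
         (r - 1)\<^sup>2 * (\<Sum>x\<in>UNIV. (cmod (diagonal A s x + diagonal A s (x - s)))\<^sup>2)))"
  proof (rule sum_mono)
    fix s
    let ?S = "(cmod (\<Sum>x\<in>UNIV. diagonal A s x))\<^sup>2"
    let ?N = "\<Sum>x\<in>UNIV. (cmod (diagonal A s x))\<^sup>2"
    let ?M = "\<Sum>x\<in>UNIV. (cmod (diagonal A s x + diagonal A s (x - s)))\<^sup>2"
    have N: "?N \<ge> 0" by (simp add: sum_nonneg)
    have "c * c \<le> 1 * 1" using c01 by (intro mult_mono) auto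
    also have "1 * 1 \<le> (r + 1) * (r + 1)" using r by (intro mult_mono) auto
    finally have "(r - 1)\<^sup>2 * c\<^sup>2 \<le> (r - 1)\<^sup>2 * (r + 1)\<^sup>2"
      by (intro mult_left_mono) (auto simp: power2_eq_square)
    also have "\<dots> = (r\<^sup>2 - 1)\<^sup>2" by (simp add: power2_eq_square algebra_simps)
    finally have main: "(r - 1)\<^sup>2 * (c\<^sup>2 * ?N) \<le> (r\<^sup>2 - 1)\<^sup>2 * ?N"
      using N by (simp only: mult.assoc[symmetric] mult_right_mono)
    have "2 + 0 \<le> real d + 2 * r\<^sup>2" using d(2) by (intro add_mono) auto
    then have main': "0 \<le> (real d + 2 * (r\<^sup>2 - 1)) * ?S"
      by (intro mult_nonneg_nonneg) (simp_all add: algebra_simps)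
    have off: "(r - 1)\<^sup>2 * (c\<^sup>2 * ?N) \<le> (r - 1)\<^sup>2 * ?M"
      using cyc by (intro mult_left_mono) auto
    \<comment> \<open>Here \<open>d \<ge> 4\<close> is used: at the extreme \<open>r = 0\<close> the
      coefficient of the squared diagonal sum is \<open>d - 4\<close>.\<close>
    have "4 + 0 \<le> real d + 4 * r" using d(2) r by (intro add_mono) auto
    then have off': "0 \<le> (real d + 4 * (r - 1)) * ?S"
      by (intro mult_nonneg_nonneg) (simp_all add: algebra_simps)
    show "(r - 1)\<^sup>2 * (c\<^sup>2 * ?N) \<le>
      (if s = 0 then (real d + 2 * (r\<^sup>2 - 1)) * ?S + (r\<^sup>2 - 1)\<^sup>2 * ?N
       else (real d + 4 * (r - 1)) * ?S + (r - 1)\<^sup>2 * ?M)"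
      using add_increasing[OF main' main] add_increasing[OF off' off] by (simp only: split: if_split) blast
  qed
  finally have "real CARD('a) * ((r - 1)\<^sup>2 * c\<^sup>2 * (norm A)\<^sup>2) \<le>
      (D d r)\<^sup>2 * (norm (orbit_measurement \<psi> (complexify (spike d 1 r)) A))\<^sup>2"
    using d(2) by (subst norm_orbit_measurement_spike_power2[OF \<psi> d(1)]) (linarith, rule mult_left_mono, auto)
  then have "(sqrt (real CARD('a)) * \<bar>r - 1\<bar> * c * norm A)\<^sup>2 \<le>
      (D d r * norm (orbit_measurement \<psi> (complexify (spike d 1 r)) A))\<^sup>2"
    by (simp only: power_mult_distrib power2_abs mult.assoc) simp
  then have "sqrt (real CARD('a)) * \<bar>r - 1\<bar> * c * norm A \<le>
      D d r * norm (orbit_measurement \<psi> (complexify (spike d 1 r)) A)"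
    by (rule power2_le_imp_le) (use D in simp)
  then show ?thesis
    using D by (simp add: c_def field_simps)
qed

text \<open>The eigenvector lives on a coset of the prime field that avoids \<open>0\<close>.\<close>

lemma ex_translation_eigenvector:
  fixes \<zeta> :: complex
  assumes "p > 0" and char: "CHAR('a) = p" and "p < CARD('a::{field, finite})"
    and \<zeta>: "\<zeta> ^ p = 1"
  shows "\<exists>v :: 'a \<Rightarrow> complex. v 0 = 0 \<and> v \<noteq> (\<lambda>_. 0) \<and> (\<forall>x. \<zeta> * v (x - 1) = v x)"
proof -
  \<comment> \<open>A starting point outside the negatives of the prime field is one from which
    adding 1 repeatedly never reaches 0.\<close>
  have "card ((\<lambda>j. - of_nat j :: 'a) ` {..<p}) \<le> p"
    using card_image_le[of "{..<p}" "\<lambda>j. - of_nat j :: 'a"] by simp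
  then have "(\<lambda>j. - of_nat j :: 'a) ` {..<p} \<noteq> UNIV"
    using assms(3) by auto
  then obtain x0 :: 'a where x0: "x0 \<notin> (\<lambda>j. - of_nat j) ` {..<p}" by blast
  \<comment> \<open>The value is \<open>\<zeta> ^ j\<close> at \<open>x0 + j\<close>. Writing it as
    a sum over \<open>j\<close> reduces the eigenvector equation to a cyclic shift of that
    sum.\<close>
  define v where "v = (\<lambda>x. \<Sum>j<p. if x = x0 + of_nat j then \<zeta> ^ j else 0)"
  have "v 0 = 0"
    unfolding v_def
  proof (intro sum.neutral ballI)
    fix j assume "j \<in> {..<p}"
    then have "0 \<noteq> x0 + of_nat j"
      using x0 by (metis add_eq_0_iff2 imageI)
    then show "(if 0 = x0 + of_nat j then \<zeta> ^ j else 0) = 0" by simp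
  qed
  moreover have "v x0 = 1"
  proof -
    \<comment> \<open>In characteristic \<open>p\<close> the walk from \<open>x0\<close> does not
      return before step \<open>p\<close>, so only \<open>j = 0\<close> contributes; this shows that
      \<open>v\<close> is not zero.\<close>
    have "(x0 = x0 + of_nat j) = (j = 0)" if "j < p" for j
      using that char by (auto simp: of_nat_eq_0_iff_char_dvd)
    then have "v x0 = (\<Sum>j<p. if j = 0 then 1 else 0)"
      unfolding v_def by (intro sum.cong refl) auto
    then show ?thesis using assms(1) by simp
  qed
  moreover have "\<zeta> * v (x - 1) = v x" for x
  proof -
    have "of_nat p = (0 :: 'a)"
      using char by (metis of_nat_CHAR)
    moreover have "\<zeta> * v (x - 1) = (\<Sum>j<p. if x = x0 + of_nat (Suc j) then \<zeta> ^ Suc j else 0)"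
      unfolding v_def sum_distrib_left by (intro sum.cong refl) (auto simp: algebra_simps)
    ultimately show ?thesis
      unfolding v_def using sum_shift_cyclic[of "\<lambda>j. if x = x0 + of_nat j then \<zeta> ^ j else 0" p] \<zeta>
      by simp
  qed
  ultimately show ?thesis
    by (intro exI[of _ v]) auto
qed

text \<open>A matrix supported on the single diagonal \<open>s = 1\<close> and carrying a
  translation eigenvector makes both estimates of the lower bound sharp: its diagonal sum is 0, and
  adding the translate multiplies every modulus by \<open>cmod (1 + \<zeta>)\<close>.\<close>

lemma ex_norm_orbit_measurement_spike_eq:
  fixes \<psi> :: "'a::{field, finite} \<Rightarrow> complex"
  assumes \<psi>: "additive_character \<psi>" "\<exists>x. \<psi> x \<noteq> 1"
    and p: "prime p" "odd p" "CARD('a) = p ^ h" "h \<ge> 2"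
    and d: "d = CARD('a) - 1" "d \<ge> 2"
  shows "\<exists>A. A \<noteq> 0 \<and> norm (orbit_measurement \<psi> (complexify (spike d 1 r)) A) =
    2 * sqrt (real CARD('a)) * (\<bar>r - 1\<bar> / D d r) * sin (pi / (2 * real p)) * norm A"
proof -
  have p1: "p > 1" using p(1) by (rule prime_gt_1_nat)
  have D: "D d r > 0" using d(2) by (rule D_pos)
  have sin_pos: "0 \<le> sin (pi / (2 * real p))"
    using p1 by (intro sin_ge_zero) (auto simp: field_simps)
  \<comment> \<open>A \<open>p\<close>-th root of unity nearest to -1. Its angle is
    \<open>(p - 1) / 2\<close> times \<open>2 * pi / p\<close>, an integer multiple because
    \<open>p\<close> is odd.\<close>
  define \<zeta> where "\<zeta> = cis (pi - pi / real p)"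
  have \<zeta>p: "\<zeta> ^ p = 1"
  proof -
    obtain k where k: "p = 2 * k + 1" using p(2) by (auto elim: oddE)
    then have "real p * (pi - pi / real p) = 2 * pi * real k"
      by (simp add: field_simps)
    then show ?thesis
      unfolding \<zeta>_def Complex.DeMoivre by (metis cis_multiple_2pi Ints_of_nat)
  qed
  have "cmod (1 + \<zeta>) = 2 * \<bar>cos (pi / 2 - pi / (2 * real p))\<bar>"
    by (simp add: \<zeta>_def cmod_one_plus_cis diff_divide_distrib mult.commute)
  then have norm_\<zeta>: "cmod (1 + \<zeta>) = 2 * sin (pi / (2 * real p))"
    using sin_pos by (simp add: cos_sin_eq)
  have "\<zeta> \<noteq> 1"
  proof
    assume "\<zeta> = 1"
    then have "sin (pi / (2 * real p)) = sin (pi / 2)" using norm_\<zeta> by simp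
    moreover have "sin (pi / (2 * real p)) < sin (pi / 2)"
    proof (rule sin_monotone_2pi)
      show "- (pi / 2) \<le> pi / (2 * real p)"
        by (rule order_trans[of _ 0]) auto
      show "pi / (2 * real p) < pi / 2"
        using p1 by (intro divide_strict_left_mono) auto
    qed simp
    ultimately show False by simp
  qed
  have "p ^ 1 < p ^ h" using p1 p(4) by (intro power_strict_increasing) auto
  then obtain v :: "'a \<Rightarrow> complex" where v: "v 0 = 0" "v \<noteq> (\<lambda>_. 0)" "\<And>x. \<zeta> * v (x - 1) = v x"
    using ex_translation_eigenvector[of p \<zeta>, where 'a = 'a] p1 p(3) \<zeta>p
      CHAR_eq_of_CARD_prime_power[OF p(1,3)] by auto
  have "\<zeta> \<noteq> 0" by (simp add: \<zeta>_def)
  \<comment> \<open>The diagonal \<open>s = 1\<close> has no entry at \<open>x = - 1\<close>, so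
    \<open>v\<close> must vanish there as well as at 0 to be realised by a matrix.\<close>
  then have vm1: "v (- 1) = 0" using v(1) v(3)[of 0] by simp
  \<comment> \<open>Translation invariance of the sum makes it a fixed point of multiplication by
    \<open>\<zeta> \<noteq> 1\<close>, hence 0.\<close>
  have "\<zeta> * (\<Sum>x\<in>UNIV. v x) = (\<Sum>x\<in>UNIV. v (x + 1))"
    using v(3)[of "_ + 1"] by (simp add: sum_distrib_left)
  also have "\<dots> = (\<Sum>x\<in>UNIV. v x)"
    by (rule sum.reindex_bij_witness[of _ "\<lambda>x. x - 1" "\<lambda>x. x + 1"]) auto
  finally have sum_v: "(\<Sum>x\<in>UNIV. v x) = 0" using \<open>\<zeta> \<noteq> 1\<close> by simp
  have "cmod \<zeta> = 1" by (simp add: \<zeta>_def)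
  have norm_v: "cmod (v x + v (x - 1)) = 2 * sin (pi / (2 * real p)) * cmod (v x)" for x
  proof -
    have "v x + v (x - 1) = (1 + \<zeta>) * v (x - 1)"
      using v(3)[of x] by (simp add: distrib_right)
    moreover have "cmod (v (x - 1)) = cmod (v x)"
      using v(3)[of x] \<open>cmod \<zeta> = 1\<close> by (metis mult_1 norm_mult)
    ultimately show ?thesis by (simp add: norm_mult norm_\<zeta>)
  qed
  define A where "A = (\<chi> m n. if val n = val m + 1 then v (val m) else 0)"
  have diag: "diagonal A s = (if s = 1 then v else (\<lambda>_. 0))" for s
    using v(1) vm1 by (auto simp: A_def diagonal_def Nonzero_inverse fun_eq_iff add_eq_0_iff2)
  have norm_A: "(norm A)\<^sup>2 = (\<Sum>x\<in>UNIV. (cmod (v x))\<^sup>2)"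
  proof -
    have "(norm A)\<^sup>2 = (\<Sum>s::'a\<in>UNIV. if s = 1 then \<Sum>x\<in>UNIV. (cmod (v x))\<^sup>2 else 0)"
      unfolding norm_matrix_power2 diag by (rule sum.cong) auto
    then show ?thesis by simp
  qed
  have "A \<noteq> 0"
  proof
    assume "A = 0"
    then have "diagonal A 1 = (\<lambda>_. 0)" by (simp add: diagonal_def fun_eq_iff)
    then show False using v(2) by (simp add: diag)
  qed
  have "(D d r)\<^sup>2 * (norm (orbit_measurement \<psi> (complexify (spike d 1 r)) A))\<^sup>2 =
      real CARD('a) * (\<Sum>s::'a\<in>UNIV. if s = 1 then
        (r - 1)\<^sup>2 * (\<Sum>x\<in>UNIV. (cmod (v x + v (x - 1)))\<^sup>2) else 0)"
    unfolding norm_orbit_measurement_spike_power2[OF \<psi> d] diag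
    by (intro arg_cong[where f = "(*) (real CARD('a))"] sum.cong refl) (auto simp: sum_v)
  also have "\<dots> = real CARD('a) * ((r - 1)\<^sup>2 * (\<Sum>x\<in>UNIV. (cmod (v x + v (x - 1)))\<^sup>2))"
    by simp
  also have "\<dots> = (sqrt (real CARD('a)) * \<bar>r - 1\<bar> * (2 * sin (pi / (2 * real p))) * norm A)\<^sup>2"
    by (simp only: norm_v power_mult_distrib sum_distrib_left[symmetric] norm_A) simp
  finally have "(D d r * norm (orbit_measurement \<psi> (complexify (spike d 1 r)) A))\<^sup>2 =
      (sqrt (real CARD('a)) * \<bar>r - 1\<bar> * (2 * sin (pi / (2 * real p))) * norm A)\<^sup>2"
    by (simp add: power_mult_distrib)
  then have "D d r * norm (orbit_measurement \<psi> (complexify (spike d 1 r)) A) =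
      sqrt (real CARD('a)) * \<bar>r - 1\<bar> * (2 * sin (pi / (2 * real p))) * norm A"
    by (rule power2_eq_imp_eq) (use D sin_pos in auto)
  then have "norm (orbit_measurement \<psi> (complexify (spike d 1 r)) A) =
      2 * sqrt (real CARD('a)) * (\<bar>r - 1\<bar> / D d r) * sin (pi / (2 * real p)) * norm A"
    using D by (simp add: field_simps)
  with \<open>A \<noteq> 0\<close> show ?thesis by blast
qed

lemma sigma_min_eqI:
  fixes T :: "complex ^ 'n ^ 'n \<Rightarrow> complex ^ 'g"
  assumes "\<And>A. c * norm A \<le> norm (T A)" and "A \<noteq> 0" "norm (T A) = c * norm A"
  shows "sigma_min T = c"
  unfolding sigma_min_def
proof (rule Least_equality)
  show "\<exists>A. A \<noteq> 0 \<and> c = norm (T A) / norm A"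
    using assms(2,3) by (intro exI[of _ A]) auto
  show "c \<le> s" if "\<exists>A. A \<noteq> 0 \<and> s = norm (T A) / norm A" for s
    using that assms(1) by (auto simp: pos_le_divide_eq)
qed

section \<open>Maximisation over the spike parameter \<open>r\<close>\<close>

lemma spike_ratio_le:
  assumes "d \<ge> 10" and "r \<ge> 0"
  shows "\<bar>r - 1\<bar> / D d r \<le> 1 / (2 * (sqrt (real d) + 1))"
    and "\<bar>r - 1\<bar> / D d r = 1 / (2 * (sqrt (real d) + 1)) \<longleftrightarrow> r = 1 + sqrt (real d)"
proof -
  define x where "x = sqrt (real d)"
  \<comment> \<open>The threshold \<open>d \<ge> 10\<close> enters as \<open>sqrt d > 3\<close>. At
    \<open>d = 9\<close> the value at \<open>r = 0\<close> would equal the one at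
    \<open>r = 1 + sqrt d\<close>.\<close>
  have "sqrt (3\<^sup>2) < x" unfolding x_def using assms(1) by (intro real_sqrt_less_mono) auto
  then have x: "x > 3" by simp
  have D: "D d r = x\<^sup>2 - 1 + r\<^sup>2" by (simp add: D_def x_def)
  have pos: "D d r > 0" using assms(1) by (intro D_pos) simp
  have main: "2 * (x + 1) * \<bar>r - 1\<bar> \<le> D d r \<and> (2 * (x + 1) * \<bar>r - 1\<bar> = D d r \<longleftrightarrow> r = 1 + x)"
  proof (cases "r \<ge> 1")
    case True
    \<comment> \<open>Completing the square gives both the bound and the uniqueness of the maximiser
      on \<open>r \<ge> 1\<close>.\<close>
    then have "D d r - 2 * (x + 1) * \<bar>r - 1\<bar> = (r - (1 + x))\<^sup>2"
      by (simp add: D power2_eq_square algebra_simps)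
    moreover have "(r - (1 + x))\<^sup>2 \<ge> 0" "(r - (1 + x))\<^sup>2 = 0 \<longleftrightarrow> r = 1 + x" by auto
    ultimately show ?thesis by linarith
  next
    case False
    \<comment> \<open>For \<open>r < 1\<close> the left side is at most \<open>2 * (x + 1)\<close>,
      and \<open>x > 3\<close> puts this strictly below \<open>x\<^sup>2 - 1\<close>, so equality
      cannot occur on this branch.\<close>
    have "2 * (x + 1) * \<bar>r - 1\<bar> \<le> 2 * (x + 1) * 1"
      using False assms(2) x by (intro mult_left_mono) auto
    also have "\<dots> < (x - 1) * (x + 1)"
      unfolding mult_1_right using x by (intro mult_strict_right_mono) auto
    also have "\<dots> \<le> D d r"
      by (simp add: D power2_eq_square algebra_simps)
    finally show ?thesis using False x by auto
  qed
  show "\<bar>r - 1\<bar> / D d r \<le> 1 / (2 * (sqrt (real d) + 1))"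
    using main pos x unfolding x_def[symmetric] by (simp add: divide_le_eq le_divide_eq mult_ac)
  have "\<bar>r - 1\<bar> / D d r = 1 / (2 * (x + 1)) \<longleftrightarrow> 2 * (x + 1) * \<bar>r - 1\<bar> = D d r"
    using pos x by (simp add: frac_eq_eq mult_ac)
  then show "\<bar>r - 1\<bar> / D d r = 1 / (2 * (sqrt (real d) + 1)) \<longleftrightarrow> r = 1 + sqrt (real d)"
    using main unfolding x_def[symmetric] by simp
qed

section \<open>Change of the distinguished coordinate\<close>

lemma eq_times_iff_times_inverse:
  fixes m c :: "'a::comm_monoid_mult"
  assumes "m * c = 1"
  shows "i = c * j \<longleftrightarrow> j = m * i"
proof -
  have "c * (m * i) = i" "m * (c * j) = j"
    using assms by (simp_all add: mult.assoc[symmetric] mult.commute[of c m])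
  then show ?thesis by auto
qed

lemma mult_perm_mult_vec:
  assumes "m * c = 1"
  shows "mult_perm c *v f = (\<chi> i. f $ (m * i))"
  using eq_times_iff_times_inverse[OF assms]
  by (simp add: vec_eq_iff matrix_vector_mult_def mult_perm_def if_distrib[of "\<lambda>x. x * _"] cong: if_cong)

lemma unitary_mult_perm: "unitary_matrix (mult_perm c)"
proof -
  obtain m where m: "m * c = 1" using nonzero_left_inverse by blast
  note iff = eq_times_iff_times_inverse[OF m]
  have inj: "c * i = c * j \<longleftrightarrow> i = j" for i j
    unfolding iff using m by (auto simp: mult.assoc[symmetric])
  have "(\<Sum>k\<in>UNIV. (if i = c * k then 1 else 0) * cnj (if j = c * k then 1 else 0)) =
      (if i = j then 1 else 0 :: complex)" for i j
  proof -
    have "(\<Sum>k\<in>UNIV. (if i = c * k then 1 else 0) * cnj (if j = c * k then 1 else 0)) =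
        (\<Sum>k\<in>UNIV. if k = m * i then (if i = j then 1 else 0 :: complex) else 0)"
      by (intro sum.cong refl) (auto simp: iff[symmetric])
    then show ?thesis by simp
  qed
  moreover have "(\<Sum>k\<in>UNIV. cnj (if k = c * i then 1 else 0) * (if k = c * j then 1 else 0)) =
      (if i = j then 1 else 0 :: complex)" for i j
  proof -
    have "(\<Sum>k\<in>UNIV. cnj (if k = c * i then 1 else 0) * (if k = c * j then 1 else 0)) =
        (\<Sum>k\<in>UNIV. if k = c * i then (if i = j then 1 else 0 :: complex) else 0)"
      by (intro sum.cong refl) (auto simp: inj)
    then show ?thesis by simp
  qed
  ultimately show ?thesis
    by (simp add: unitary_matrix_def mult_perm_def matrix_matrix_mult_def mat_def)
qed

lemma cinner_unitary:
  assumes "unitary_matrix U"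
  shows "cinner (U *v x) (U *v y) = cinner x y"
proof -
  have "(\<Sum>i\<in>UNIV. U $ i $ k * cnj (U $ i $ j)) = (if j = k then 1 else 0)" for j k
  proof -
    have "((\<chi> i j. cnj (U $ j $ i)) ** U) $ j $ k = (mat 1 :: complex ^ 'a ^ 'a) $ j $ k"
      using assms by (simp add: unitary_matrix_def)
    then show ?thesis by (simp add: matrix_matrix_mult_def mat_def mult.commute)
  qed
  note orth = this
  have "cinner (U *v x) (U *v y) =
      (\<Sum>i\<in>UNIV. \<Sum>k\<in>UNIV. \<Sum>j\<in>UNIV. x $ k * cnj (y $ j) * (U $ i $ k * cnj (U $ i $ j)))"
    by (simp add: cinner_def matrix_vector_mult_def sum_product mult_ac)
  also have "\<dots> = (\<Sum>k\<in>UNIV. \<Sum>j\<in>UNIV. \<Sum>i\<in>UNIV. x $ k * cnj (y $ j) * (U $ i $ k * cnj (U $ i $ j)))"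
    by (subst sum.swap) (rule sum.cong[OF refl], rule sum.swap)
  also have "\<dots> = (\<Sum>k\<in>UNIV. \<Sum>j\<in>UNIV. if j = k then x $ k * cnj (y $ j) else 0)"
    by (intro sum.cong refl) (simp add: sum_distrib_left[symmetric] orth)
  also have "\<dots> = cinner x y"
    by (simp add: cinner_def)
  finally show ?thesis .
qed

text \<open>Permuting coordinates by \<open>c\<close> replaces the phase
  \<open>\<psi> (k * n)\<close> at coordinate \<open>n\<close> by \<open>\<psi> (k * n / c)\<close>.
  This is undone by rescaling the translation part of the group element, which is an automorphism
  because dilations commute with each other.\<close>

lemma unitarily_equivalent_orbits_mult_perm:
  "unitarily_equivalent_orbits \<psi> (mult_perm c) \<phi> (mult_perm c *v \<phi>)"
proof -
  obtain m where m: "m * c = 1" using nonzero_left_inverse by blast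
  \<comment> \<open>Here \<open>m\<close> is the inverse of \<open>c\<close>, so
    \<open>\<alpha>\<close> divides the translation part by \<open>c\<close> and fixes the dilation
    part.\<close>
  define \<alpha> where "\<alpha> = (\<lambda>(k, l). (val m * k, l :: 'a nonzero))"
  have vm: "val m * val c = 1" using m by (metis val_times val_one)
  have iso: "\<alpha> \<in> iso affine_group affine_group"
  proof (rule isoI)
    show "\<alpha> \<in> hom affine_group affine_group"
      by (rule homI) (auto simp: \<alpha>_def affine_group_def algebra_simps)
    show "bij_betw \<alpha> (carrier affine_group) (carrier affine_group)"
      unfolding affine_group_def partial_object.simps
    proof (rule bij_betw_byWitness[where f' = "\<lambda>(k, l). (val c * k, l)"])
      have "val m * (val c * k) = k" "val c * (val m * k) = k" for k
        using vm by (simp_all add: mult.assoc[symmetric] mult.commute[of "val c"])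
      then show "\<forall>g\<in>UNIV. (case \<alpha> g of (k, l) \<Rightarrow> (val c * k, l)) = g"
        "\<forall>g\<in>UNIV. \<alpha> (case g of (k, l) \<Rightarrow> (val c * k, l)) = g"
        by (auto simp: \<alpha>_def)
    qed auto
  qed
  have intertwine: "affine_rep \<psi> (\<alpha> g) (mult_perm c *v \<phi>) = mult_perm c *v affine_rep \<psi> g \<phi>" for g
    by (simp add: mult_perm_mult_vec[OF m] affine_rep_def \<alpha>_def vec_eq_iff split_beta mult_ac)
  have "orbit_measurement \<psi> (mult_perm c *v \<phi>)
      (mult_perm c ** A ** (\<chi> i j. cnj (mult_perm c $ j $ i))) $ \<alpha> g = orbit_measurement \<psi> \<phi> A $ g" for A g
  proof -
    have "(mult_perm c ** A ** (\<chi> i j. cnj (mult_perm c $ j $ i))) *v (mult_perm c *v w) =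
        mult_perm c *v (A *v w)" for w
    proof -
      have "(mult_perm c ** A ** (\<chi> i j. cnj (mult_perm c $ j $ i))) *v (mult_perm c *v w) =
        (mult_perm c ** A ** ((\<chi> i j. cnj (mult_perm c $ j $ i)) ** mult_perm c)) *v w"
        by (simp add: matrix_vector_mul_assoc matrix_mul_assoc)
      also have "\<dots> = mult_perm c *v (A *v w)"
        using unitary_mult_perm[of c] by (simp add: unitary_matrix_def matrix_vector_mul_assoc)
      finally show ?thesis .
    qed
    then show ?thesis
      by (simp add: orbit_measurement_def intertwine cinner_unitary[OF unitary_mult_perm])
  qed
  with iso intertwine unitary_mult_perm show ?thesis
    unfolding unitarily_equivalent_orbits_def by blast
qed

lemma complexify_spike_eq_mult_perm:
  "complexify (spike d c r) = mult_perm c *v complexify (spike d 1 r)"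
proof -
  obtain m where m: "m * c = 1" using nonzero_left_inverse by blast
  then have "m * i = 1 \<longleftrightarrow> i = c" for i
    by (metis mult.assoc mult.commute mult_1_left)
  then show ?thesis
    by (simp add: mult_perm_mult_vec[OF m] complexify_def spike_def vec_eq_iff)
qed

theorem theorem6p4:
  fixes \<psi> :: "'a::{field, finite} \<Rightarrow> complex" and p h q d :: nat
  assumes "prime p" and "odd p" and "h \<ge> 2" and "q = p ^ h" and "d = q - 1"
    and "CARD('a) = q"
    and "additive_character \<psi>" and "\<exists>x. \<psi> x \<noteq> 1"
  defines "\<sigma> \<equiv> (\<lambda>r. sigma_min (orbit_measurement \<psi> (complexify (spike d (1 :: 'a nonzero) r))))"
  shows "(\<forall>r\<ge>0. \<sigma> r = 2 * sqrt (real q) * (\<bar>r - 1\<bar> / D d r) * sin (pi / (2 * real p)))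
    \<and> (d \<ge> 10 \<longrightarrow>
        (GREATEST s. s \<in> \<sigma> ` {0..}) = sqrt (real q) / (sqrt (real d) + 1) * sin (pi / (2 * real p))
        \<and> (\<forall>r. is_arg_max \<sigma> (\<lambda>r. r \<ge> 0) r \<longleftrightarrow> r = 1 + sqrt (real d)))
    \<and> (\<forall>c :: 'a nonzero. \<forall>r\<ge>0.
        complexify (spike d c r) = mult_perm c *v complexify (spike d 1 r)
        \<and> unitarily_equivalent_orbits \<psi> (mult_perm c)
            (complexify (spike d 1 r)) (complexify (spike d c r)))"
proof -
  have "p \<noteq> 2" using assms(2) by auto
  then have p3: "p \<ge> 3" using prime_ge_2_nat[OF assms(1)] by linarith
  \<comment> \<open>An odd prime and \<open>h \<ge> 2\<close> give \<open>q \<ge> 9\<close>, so the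
    lower bound on \<open>d\<close> behind the singular value formula always holds.\<close>
  have "3 ^ 2 \<le> p ^ 2" using p3 by (intro power_mono) auto
  also have "\<dots> \<le> p ^ h" using p3 assms(3) by (intro power_increasing) auto
  finally have d8: "d \<ge> 8" using assms(4,5) by simp
  then have d: "d \<ge> 2" "d \<ge> 4" by auto
  have card: "CARD('a) = p ^ h" "d = CARD('a) - 1" "real CARD('a) = real q"
    using assms(4-6) by auto
  note sin_pos = sin_pi_half_bounds(1)[OF p3]
  \<comment> \<open>All factors independent of \<open>r\<close> are collected in a positive
    constant, so maximising \<open>\<sigma>\<close> is the same as maximising the ratio.\<close>
  define c where "c = 2 * sqrt (real q) * sin (pi / (2 * real p))"
  have "q > 0" using assms(4) p3 by simp
  then have c: "c > 0" using sin_pos by (simp add: c_def)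
  have sigma_eq: "\<sigma> r = 2 * sqrt (real q) * (\<bar>r - 1\<bar> / D d r) * sin (pi / (2 * real p))" if "r \<ge> 0" for r
  proof -
    obtain A where "A \<noteq> 0" "norm (orbit_measurement \<psi> (complexify (spike d 1 r)) A) =
        2 * sqrt (real q) * (\<bar>r - 1\<bar> / D d r) * sin (pi / (2 * real p)) * norm A"
      using ex_norm_orbit_measurement_spike_eq[OF assms(7,8,1,2) card(1) assms(3) card(2) d(1), of r]
      unfolding card(3) by blast
    moreover have "2 * sqrt (real q) * (\<bar>r - 1\<bar> / D d r) * sin (pi / (2 * real p)) * norm A \<le>
        norm (orbit_measurement \<psi> (complexify (spike d 1 r)) A)" for A
      using norm_orbit_measurement_spike_ge[OF assms(7,8,1,2) card(1,2) d(2) that] unfolding card(3) .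
    ultimately show ?thesis
      unfolding \<sigma>_def by (intro sigma_min_eqI)
  qed
  then have ratio: "\<sigma> r = c * (\<bar>r - 1\<bar> / D d r)" if "r \<ge> 0" for r
    using that by (simp add: c_def)
  have optimum: "(GREATEST s. s \<in> \<sigma> ` {0..}) = sqrt (real q) / (sqrt (real d) + 1) * sin (pi / (2 * real p))
      \<and> (\<forall>r. is_arg_max \<sigma> (\<lambda>r. r \<ge> 0) r \<longleftrightarrow> r = 1 + sqrt (real d))" if d10: "d \<ge> 10"
  proof -
    define M where "M = c * (1 / (2 * (sqrt (real d) + 1)))"
    have M: "M = sqrt (real q) / (sqrt (real d) + 1) * sin (pi / (2 * real p))"
    proof -
      have "2 * a * b * (1 / (2 * x)) = a / x * b" for a b x :: real by simp
      then show ?thesis unfolding M_def c_def .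
    qed
    have le: "\<sigma> r \<le> M" if "r \<ge> 0" for r
      unfolding M_def ratio[OF that] using c spike_ratio_le(1)[OF d10 that]
      by (intro mult_left_mono) auto
    have eq: "\<sigma> r = M \<longleftrightarrow> r = 1 + sqrt (real d)" if "r \<ge> 0" for r
      unfolding M_def ratio[OF that] spike_ratio_le(2)[OF d10 that, symmetric]
      using c by (simp only: mult_cancel_left) auto
    have r0: "1 + sqrt (real d) \<ge> 0" by (intro add_nonneg_nonneg) auto
    then have at: "\<sigma> (1 + sqrt (real d)) = M" using eq by simp
    have "(GREATEST s. s \<in> \<sigma> ` {0..}) = M"
      using le r0 by (intro Greatest_equality) (auto simp: at[symmetric])
    moreover have "is_arg_max \<sigma> (\<lambda>r. r \<ge> 0) r \<longleftrightarrow> r = 1 + sqrt (real d)" for r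
      unfolding is_arg_max_linorder using le eq at r0 by (metis antisym)
    ultimately show ?thesis using M by simp
  qed
  show ?thesis
    using sigma_eq optimum complexify_spike_eq_mult_perm unitarily_equivalent_orbits_mult_perm by metis
qed

end
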